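(* Let $\mathcal{T}$ be a complete infinitely distributive lattice with a De Morgan complement. The following are equivalent: (i) $F$-justified revisions and justified revisions coincide over $\mathcal{T}$, i.e. for every universe $U$ of atoms, every annotated revision program $P$ over $U$ with annotations in $\mathcal{T}$, and all $\mathcal{T}^2$-valuations $B_I,B_R$ of $U$, $B_R$ is an $F$-justified revision of $B_I$ under $P$ if and only if $B_R$ is a $P$-justified revision of $B_I$; (ii) $\mathcal{T}$ is linear, i.e. for all $\alpha,\beta\in\mathcal{T}$ either $\alpha\le\beta$ or $\beta\le\alpha$.
   Context: Lattice: $\mathcal{T}$ is a complete lattice with order $\le$, operations $\wedge,\vee$, bottom $\bot$, top $\top$, satisfying both infinite distributive laws ($a\vee\bigwedge S=\bigwedge_{s\in S}(a\vee s)$ and $a\wedge\bigvee S=\bigvee_{s\in S}(a\wedge s)$), with a De Morgan complement $\alpha\mapsto\overline{\alpha}$ (an order-reversing involution). Programs: $U$ is a set of atoms. Revision atoms are the formal expressions $\mathbf{in}(a)$, $\mathbf{out}(a)$, $a\in U$. An annotated revision atom is $(l:\alpha)$ with $l$ a revision atom and $\alpha\in\mathcal{T}$. An annotated revision rule is $p\leftarrow q_1,\dots,q_n$ ($n\ge 0$) with $p$ (head) and $q_1,\dots,q_n$ (body) annotated revision atoms. An annotated revision program is a set of such rules. Valuations: $\mathcal{T}^2=\mathcal{T}\times\mathcal{T}$ is ordered by $\langle\alpha_1,\beta_1\rangle\le_k\langle\alpha_2,\beta_2\rangle$ iff $\alpha_1\le\alpha_2$ and $\beta_1\le\beta_2$;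 its meet and join are $\otimes,\oplus$. Conflation is $-\langle\alpha,\beta\rangle=\langle\overline{\beta},\overline{\alpha}\rangle$. A $\mathcal{T}^2$-valuation is a map $B:U\to\mathcal{T}^2$; $\le_k,\otimes,\oplus,-$ are extended pointwise. If $B(a)=\langle\alpha,\beta\rangle$, write $B[\mathbf{in}(a)]=\alpha$, $B[\mathbf{out}(a)]=\beta$. $B$ satisfies $(l:\alpha)$ if $\alpha\le B[l]$, and satisfies a body if it satisfies each of its members. Operator and necessary change: $T_P^b(B)$ is the $\mathcal{T}^2$-valuation with $T_P^b(B)[l]=\bigvee\{\alpha : (l:\alpha)$ is the head of a rule of $P$ whose body is satisfied by $B\}$ for each revision atom $l$. It is $\le_k$-monotone; its least fixpoint is the necessary change $NC(P)$. Justified revisions: $\mathit{pcomp}(\alpha,\beta)$ is the least $\gamma\in\mathcal{T}$ with $\alpha\vee\gamma\ge\beta$. The reduct $P_{B_R}|B_I$ is obtained from $P$ by (1) removing every rule whose body contains an annotated revision atom not satisfied by $B_R$, and (2) replacing each $(l:\beta)$ in the body of each remaining rule by $(l:\mathit{pcomp}(B_I[l],\beta))$. $B_R$ is a $P$-justified revision of $B_I$ if $B_R=(B_I\otimes -C)\oplus C$ where $C=NC(P_{B_R}|B_I)$. $F$-justified revisions: the $F$-reduct $P^F_{B_R}|B_I$ is obtained from $P$ by (1) removing every rule whose body contains an annotated revision atom not satisfied by $B_R$, and (2) deleting from the body of each remaining rule every annotated revision atom satisfied by $B_I$. $B_R$ is an $F$-justified revision of $B_I$ under $P$ if $B_R=(B_I\otimes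 -C)\oplus C$ where $C=NC(P^F_{B_R}|B_I)$. *)

theory Defs
  imports "HOL-Library.Product_Order"
begin

text \<open>
  The lattice is a type of class \<^class>\<open>complete_lattice\<close>; its infinite distributive laws
  and its De Morgan complement are explicit hypotheses of the theorem.  The library class
  \<^class>\<open>complete_distrib_lattice\<close> is not used: it asserts complete distributivity, which is
  strictly stronger than the two infinite distributive laws.
\<close>

datatype 'u revision_atom = In 'u | Out 'u

type_synonym ('u, 't) annotated_atom = "'u revision_atom \<times> 't"

text \<open>A rule is a pair of a head and a body, the body being the finite list of its members.\<close>

type_synonym ('u, 't) annotated_rule = "('u, 't) annotated_atom \<times> ('u, 't) annotated_atom list"

type_synonym ('u, 't) annotated_program = "('u, 't) annotated_rule set"

text \<open>
  Valuations carry the pointwise order of the componentwise order on pairs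
  (\<^theory>\<open>HOL-Library.Product_Order\<close>), which is the knowledge order; its meet and join
  are \<^const>\<open>inf\<close> and \<^const>\<open>sup\<close>.

  A universe is a set of atoms of type \<open>'u\<close>, and a valuation of the universe \<open>U\<close> is represented
  by its extension with the value bottom outside \<open>U\<close>.  For a program over \<open>U\<close> the necessary
  change is again bottom outside \<open>U\<close>, and so is
  \<open>sup (inf B\<^sub>I (conflation cpl C)) C\<close> whenever \<open>B\<^sub>I\<close> and \<open>C\<close> are; hence equality of these
  extensions is equality of valuations of \<open>U\<close>.
\<close>

type_synonym ('u, 't) valuation = "'u \<Rightarrow> 't \<times> 't"

definition valuation_on :: "'u set \<Rightarrow> ('u, 't::complete_lattice) valuation \<Rightarrow> bool" where
  "valuation_on U B \<longleftrightarrow> (\<forall>a. a \<notin> U \<longrightarrow> B a = bot)"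

fun atom_of :: "'u revision_atom \<Rightarrow> 'u" where
  "atom_of (In a) = a"
| "atom_of (Out a) = a"

definition program_over :: "'u set \<Rightarrow> ('u, 't) annotated_program \<Rightarrow> bool" where
  "program_over U P \<longleftrightarrow>
     (\<forall>(p, body) \<in> P. \<forall>q \<in> insert p (set body). atom_of (fst q) \<in> U)"

fun val :: "('u, 't) valuation \<Rightarrow> 'u revision_atom \<Rightarrow> 't" where
  "val B (In a) = fst (B a)"
| "val B (Out a) = snd (B a)"

definition sat :: "('u, 't::complete_lattice) valuation \<Rightarrow> ('u, 't) annotated_atom \<Rightarrow> bool" where
  "sat B q \<longleftrightarrow> snd q \<le> val B (fst q)"

definition sat_body ::
    "('u, 't::complete_lattice) valuation \<Rightarrow> ('u, 't) annotated_atom list \<Rightarrow> bool" where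
  "sat_body B body \<longleftrightarrow> (\<forall>q \<in> set body. sat B q)"

definition head_annotations ::
    "('u, 't::complete_lattice) annotated_program \<Rightarrow> ('u, 't) valuation
      \<Rightarrow> 'u revision_atom \<Rightarrow> 't set" where
  "head_annotations P B l = {\<alpha>. \<exists>body. ((l, \<alpha>), body) \<in> P \<and> sat_body B body}"

definition T_b ::
    "('u, 't::complete_lattice) annotated_program \<Rightarrow> ('u, 't) valuation \<Rightarrow> ('u, 't) valuation" where
  "T_b P B = (\<lambda>a. (Sup (head_annotations P B (In a)), Sup (head_annotations P B (Out a))))"

definition NC :: "('u, 't::complete_lattice) annotated_program \<Rightarrow> ('u, 't) valuation" where
  "NC P = lfp (T_b P)"

lemma val_mono: "B \<le> B' \<Longrightarrow> val B l \<le> val B' l"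
  by (cases l) (auto simp: le_fun_def less_eq_prod_def)

text \<open>Monotonicity, so that \<^const>\<open>lfp\<close> in \<^const>\<open>NC\<close> is indeed the least fixpoint.\<close>

lemma mono_T_b:
  fixes P :: "('u, 't::complete_lattice) annotated_program"
  shows "mono (T_b P)"
proof (rule monoI)
  fix B B' :: "('u, 't) valuation"
  assume "B \<le> B'"
  then have "head_annotations P B l \<subseteq> head_annotations P B' l" for l
    unfolding head_annotations_def sat_body_def sat_def
    by (blast intro: order_trans val_mono)
  then show "T_b P B \<le> T_b P B'"
    by (auto simp: T_b_def le_fun_def less_eq_prod_def intro: Sup_subset_mono)
qed

lemma NC_unfold: "NC P = T_b P (NC P)"
  unfolding NC_def by (rule lfp_unfold[OF mono_T_b])

text \<open>The first argument of \<open>conflation\<close> is the De Morgan complement of the lattice.\<close>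

definition conflation :: "('t \<Rightarrow> 't) \<Rightarrow> ('u, 't) valuation \<Rightarrow> ('u, 't) valuation" where
  "conflation cpl B = (\<lambda>a. (cpl (snd (B a)), cpl (fst (B a))))"

definition revision_by ::
    "('t::complete_lattice \<Rightarrow> 't) \<Rightarrow> ('u, 't) valuation \<Rightarrow> ('u, 't) valuation
      \<Rightarrow> ('u, 't) valuation" where
  "revision_by cpl B\<^sub>I C = sup (inf B\<^sub>I (conflation cpl C)) C"

definition pcomp :: "'t::complete_lattice \<Rightarrow> 't \<Rightarrow> 't" where
  "pcomp \<alpha> \<beta> = (LEAST \<gamma>. \<beta> \<le> sup \<alpha> \<gamma>)"

text \<open>The least element exists by the first infinite distributive law.\<close>

lemma pcomp_least:
  fixes \<alpha> \<beta> :: "'t::complete_lattice"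
  assumes "\<And>(a::'t) S. sup a (Inf S) = (INF s\<in>S. sup a s)"
  shows "\<beta> \<le> sup \<alpha> (pcomp \<alpha> \<beta>)" and "\<beta> \<le> sup \<alpha> \<gamma> \<Longrightarrow> pcomp \<alpha> \<beta> \<le> \<gamma>"
proof -
  have "\<beta> \<le> sup \<alpha> (Inf {\<gamma>. \<beta> \<le> sup \<alpha> \<gamma>})"
    unfolding assms by (rule INF_greatest) simp
  moreover from this have "pcomp \<alpha> \<beta> = Inf {\<gamma>. \<beta> \<le> sup \<alpha> \<gamma>}"
    unfolding pcomp_def by (rule Least_equality) (simp add: Inf_lower)
  ultimately show "\<beta> \<le> sup \<alpha> (pcomp \<alpha> \<beta>)" and "\<beta> \<le> sup \<alpha> \<gamma> \<Longrightarrow> pcomp \<alpha> \<beta> \<le> \<gamma>"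
    by (simp_all add: Inf_lower)
qed

text \<open>In both reducts the argument order is \<open>P\<close>, \<open>B\<^sub>R\<close>, \<open>B\<^sub>I\<close>.\<close>

definition reduct ::
    "('u, 't::complete_lattice) annotated_program \<Rightarrow> ('u, 't) valuation \<Rightarrow> ('u, 't) valuation
      \<Rightarrow> ('u, 't) annotated_program" where
  "reduct P B\<^sub>R B\<^sub>I =
     {(p, map (\<lambda>(l, \<beta>). (l, pcomp (val B\<^sub>I l) \<beta>)) body) | p body.
        (p, body) \<in> P \<and> sat_body B\<^sub>R body}"

definition F_reduct ::
    "('u, 't::complete_lattice) annotated_program \<Rightarrow> ('u, 't) valuation \<Rightarrow> ('u, 't) valuation
      \<Rightarrow> ('u, 't) annotated_program" where
  "F_reduct P B\<^sub>R B\<^sub>I =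
     {(p, filter (\<lambda>q. \<not> sat B\<^sub>I q) body) | p body. (p, body) \<in> P \<and> sat_body B\<^sub>R body}"

definition justified_revision ::
    "('t::complete_lattice \<Rightarrow> 't) \<Rightarrow> ('u, 't) annotated_program
      \<Rightarrow> ('u, 't) valuation \<Rightarrow> ('u, 't) valuation \<Rightarrow> bool" where
  "justified_revision cpl P B\<^sub>I B\<^sub>R \<longleftrightarrow> B\<^sub>R = revision_by cpl B\<^sub>I (NC (reduct P B\<^sub>R B\<^sub>I))"

definition F_justified_revision ::
    "('t::complete_lattice \<Rightarrow> 't) \<Rightarrow> ('u, 't) annotated_program
      \<Rightarrow> ('u, 't) valuation \<Rightarrow> ('u, 't) valuation \<Rightarrow> bool" where
  "F_justified_revision cpl P B\<^sub>I B\<^sub>R \<longleftrightarrow> B\<^sub>R = revision_by cpl B\<^sub>I (NC (F_reduct P B\<^sub>R B\<^sub>I))"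

end

theory Submission
  imports Defs
begin

text \<open>
  Over a chain \<open>pcomp \<alpha> \<beta>\<close> is bottom if \<open>\<beta> \<le> \<alpha>\<close> and \<open>\<beta>\<close> otherwise, so both reducts have the
  same necessary change.  Conversely, let \<open>\<alpha>\<close> and \<open>\<beta>\<close> be incomparable, \<open>s = \<alpha> \<or> \<beta>\<close> and
  \<open>p = pcomp \<alpha> s\<close>; then \<open>p \<le> \<beta>\<close>, so \<open>p < s\<close>.  For the program consisting of the rules
  \<open>(in(a) : p) \<leftarrow>\<close> and \<open>(in(a) : s) \<leftarrow> (in(a) : s)\<close> and the initial valuation
  \<open>a \<mapsto> (\<alpha>, \<top>)\<close>, the second rule fires in the reduct, where its body is weakened to \<open>p\<close>, but not
  in the \<open>F\<close>-reduct.  The resulting value of \<open>in(a)\<close> is \<open>s\<close> either way, because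
  \<open>\<alpha> \<or> p = s\<close>; the difference shows in \<open>out(a)\<close>, which is lowered to the complement of \<open>s\<close>
  in the one case and of \<open>p\<close> in the other.
\<close>

lemma pcomp_eq_bot: "\<beta> \<le> \<alpha> \<Longrightarrow> pcomp \<alpha> \<beta> = bot"
  unfolding pcomp_def by (rule Least_equality) auto

text \<open>In a chain \<open>sup \<alpha> \<gamma>\<close> is one of its two arguments, and
  \<alpha> is ruled out as an upper bound of \<beta>.\<close>

lemma pcomp_eq_right:
  fixes \<alpha> \<beta> :: "'t::complete_lattice"
  assumes linear: "\<And>a b::'t. a \<le> b \<or> b \<le> a" and "\<not> \<beta> \<le> \<alpha>"
  shows "pcomp \<alpha> \<beta> = \<beta>"
  unfolding pcomp_def
proof (rule Least_equality)
  fix \<gamma> assume "\<beta> \<le> sup \<alpha> \<gamma>"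
  then show "\<beta> \<le> \<gamma>"
    using linear[of \<alpha> \<gamma>] \<open>\<not> \<beta> \<le> \<alpha>\<close> by (auto simp: sup_absorb1 sup_absorb2)
qed simp

text \<open>\<open>T_b\<close> sees a program only through \<open>head_annotations\<close>, so
  programs with different bodies can be compared without being equal as sets.\<close>

lemma NC_cong:
  assumes "\<And>B l. head_annotations P B l = head_annotations Q B l"
  shows "NC P = NC Q"
proof -
  have "T_b P = T_b Q"
    by (simp add: T_b_def assms fun_eq_iff)
  then show ?thesis
    by (simp add: NC_def)
qed

lemma NC_reduct_eq_NC_F_reduct:
  fixes P :: "('u, 't::complete_lattice) annotated_program"
  assumes linear: "\<And>a b::'t. a \<le> b \<or> b \<le> a"
  shows "NC (reduct P B\<^sub>R B\<^sub>I) = NC (F_reduct P B\<^sub>R B\<^sub>I)"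
proof (rule NC_cong)
  \<comment> \<open>An atom weakened to bottom always holds, which has the effect of deleting it;
    any other atom stays as it is.\<close>
  have sat_pcomp: "sat B (fst q, pcomp (val B\<^sub>I (fst q)) (snd q)) \<longleftrightarrow> sat B\<^sub>I q \<or> sat B q"
    for B and q :: "('u, 't) annotated_atom"
    by (cases "snd q \<le> val B\<^sub>I (fst q)") (simp_all add: sat_def pcomp_eq_bot pcomp_eq_right[OF linear])
  have "sat_body B (map (\<lambda>(l, \<beta>). (l, pcomp (val B\<^sub>I l) \<beta>)) body)
      \<longleftrightarrow> sat_body B (filter (\<lambda>q. \<not> sat B\<^sub>I q) body)" for B body
    by (auto simp: sat_body_def split_def sat_pcomp)
  then show "head_annotations (reduct P B\<^sub>R B\<^sub>I) B l = head_annotations (F_reduct P B\<^sub>R B\<^sub>I) B l" for B l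
    by (auto simp: head_annotations_def reduct_def F_reduct_def)
qed

lemma NC_lowerbound: "T_b P B \<le> B \<Longrightarrow> NC P \<le> B"
  unfolding NC_def by (rule lfp_lowerbound)

text \<open>Firing a rule gives a lower bound for \<open>NC\<close>; upper bounds come from
  prefixpoints via \<open>NC_lowerbound\<close>.\<close>

lemma NC_head_le:
  assumes "((l, \<alpha>), body) \<in> P" and "sat_body (NC P) body"
  shows "\<alpha> \<le> val (NC P) l"
proof -
  have "\<alpha> \<le> val (T_b P (NC P)) l"
    using assms by (cases l) (auto simp: T_b_def head_annotations_def intro!: Sup_upper)
  then show ?thesis
    by (simp add: NC_unfold[symmetric])
qed

lemma F_reduct_eq_self:
  assumes "\<And>p body. (p, body) \<in> P \<Longrightarrow> sat_body B\<^sub>R body"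
    and "\<And>p body q. (p, body) \<in> P \<Longrightarrow> q \<in> set body \<Longrightarrow> \<not> sat B\<^sub>I q"
  shows "F_reduct P B\<^sub>R B\<^sub>I = P"
proof -
  have "filter (\<lambda>q. \<not> sat B\<^sub>I q) body = body" if "(p, body) \<in> P" for p body
    using assms(2)[OF that] by (blast intro: filter_True)
  then show ?thesis
    using assms(1) by (auto simp: F_reduct_def) metis
qed

lemma justified_but_not_F_justified:
  fixes cpl :: "'t::complete_lattice \<Rightarrow> 't" and \<alpha> \<beta> :: 't and a :: 'u
  assumes sup_Inf_distrib: "\<And>(a::'t) S. sup a (Inf S) = (INF s\<in>S. sup a s)"
    and cpl_antimono: "antimono cpl"
    and cpl_involution: "\<And>a. cpl (cpl a) = a"
    and incomparable: "\<not> \<alpha> \<le> \<beta>" "\<not> \<beta> \<le> \<alpha>"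
  obtains P :: "('u, 't) annotated_program" and B\<^sub>I B\<^sub>R
  where "justified_revision cpl P B\<^sub>I B\<^sub>R" and "\<not> F_justified_revision cpl P B\<^sub>I B\<^sub>R"
    and "program_over {a} P" and "valuation_on {a} B\<^sub>I" and "valuation_on {a} B\<^sub>R"
proof -
  define s where "s = sup \<alpha> \<beta>"
  define p where "p = pcomp \<alpha> s"
  define P :: "('u, 't) annotated_program"
    where "P = {((In a, p), []), ((In a, s), [(In a, s)])}"
  define B\<^sub>I :: "('u, 't) valuation" where "B\<^sub>I = (\<lambda>_. bot)(a := (\<alpha>, top))"
  \<comment> \<open>The reducts depend on \<open>B\<^sub>R\<close>, so it is fixed beforehand as the
    revision of \<open>B\<^sub>I\<close> by the change \<open>(s, bot)\<close> at \<open>a\<close>.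
    It satisfies both bodies, so no rule is removed.\<close>
  define B\<^sub>R :: "('u, 't) valuation" where "B\<^sub>R = (\<lambda>_. bot)(a := (s, cpl s))"
  have cpl_bot: "cpl bot = top"
    using antimonoD[OF cpl_antimono, of bot "cpl top"] by (simp add: cpl_involution top_unique)
  have "p \<le> \<beta>"
    unfolding p_def by (rule pcomp_least(2)[OF sup_Inf_distrib]) (simp add: s_def)
  have "\<alpha> \<le> s" and "p \<le> s"
    using \<open>p \<le> \<beta>\<close> by (auto simp: s_def intro: le_supI2)
  have "\<not> s \<le> p"
    using \<open>\<alpha> \<le> s\<close> \<open>p \<le> \<beta>\<close> incomparable(1) by (blast intro: order_trans)
  have "\<not> s \<le> \<alpha>"
    using incomparable(2) by (simp add: s_def)

  have reduct: "reduct P B\<^sub>R B\<^sub>I = {((In a, p), []), ((In a, s), [(In a, p)])}" (is "_ = ?Q")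
    by (auto simp: reduct_def P_def sat_body_def sat_def B\<^sub>R_def B\<^sub>I_def p_def
        intro!: exI[of _ "[(In a, s)]"])
  \<comment> \<open>Both heads are at most \<open>s\<close>; conversely the fact yields
    \<open>p\<close>, and this fires the rule for \<open>s\<close>.\<close>
  have "NC ?Q = (\<lambda>_. bot)(a := (s, bot))" (is "_ = ?C")
  proof (rule antisym)
    have "T_b ?Q ?C \<le> ?C"
      using \<open>p \<le> s\<close>
      by (auto simp: T_b_def head_annotations_def le_fun_def less_eq_prod_def bot_prod_def
          intro!: Sup_least)
    then show "NC ?Q \<le> ?C"
      by (rule NC_lowerbound)
    have "p \<le> val (NC ?Q) (In a)"
      by (rule NC_head_le[where body = "[]"]) (simp_all add: sat_body_def)
    then have "s \<le> val (NC ?Q) (In a)"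
      by (intro NC_head_le[where body = "[(In a, p)]"]) (simp_all add: sat_body_def sat_def)
    then show "?C \<le> NC ?Q"
      by (auto simp: le_fun_def less_eq_prod_def)
  qed
  then have "NC (reduct P B\<^sub>R B\<^sub>I) = ?C"
    by (simp only: reduct)
  then have "justified_revision cpl P B\<^sub>I B\<^sub>R"
    using \<open>\<alpha> \<le> s\<close>
    unfolding justified_revision_def
    by (simp add: revision_by_def conflation_def B\<^sub>I_def B\<^sub>R_def fun_eq_iff
        sup_prod_def inf_prod_def bot_prod_def cpl_bot sup_absorb2)

  moreover have "\<not> F_justified_revision cpl P B\<^sub>I B\<^sub>R"
  proof
    have F_reduct: "F_reduct P B\<^sub>R B\<^sub>I = P"
      using \<open>\<not> s \<le> \<alpha>\<close>
      by (intro F_reduct_eq_self) (auto simp: P_def sat_body_def sat_def B\<^sub>R_def B\<^sub>I_def)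
    \<comment> \<open>The value \<open>p\<close> does not satisfy the unweakened body, so iteration
      stops at the fact.\<close>
    have "T_b P ((\<lambda>_. bot)(a := (p, bot))) \<le> (\<lambda>_. bot)(a := (p, bot))"
      using \<open>\<not> s \<le> p\<close>
      by (auto simp: T_b_def head_annotations_def P_def sat_body_def sat_def
          le_fun_def less_eq_prod_def bot_prod_def intro!: Sup_least)
    then have "NC P \<le> (\<lambda>_. bot)(a := (p, bot))"
      by (rule NC_lowerbound)
    then have "fst (NC P a) \<le> p"
      by (auto dest: val_mono[of _ _ "In a"])
    moreover assume "F_justified_revision cpl P B\<^sub>I B\<^sub>R"
    \<comment> \<open>In this component \<open>B\<^sub>I\<close> is top, so the meet leaves the full
      complement of the change of in(a). Undoing the complement bounds that change below by
      \<open>s\<close>, against the upper bound \<open>p\<close>.\<close>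
    then have "snd (B\<^sub>R a) = snd (revision_by cpl B\<^sub>I (NC P) a)"
      by (simp only: F_justified_revision_def F_reduct)
    then have "cpl s = sup (cpl (fst (NC P a))) (snd (NC P a))"
      by (simp add: revision_by_def conflation_def B\<^sub>I_def B\<^sub>R_def sup_prod_def inf_prod_def)
    then have "cpl (fst (NC P a)) \<le> cpl s"
      by simp
    then have "s \<le> fst (NC P a)"
      using antimonoD[OF cpl_antimono, of "cpl (fst (NC P a))" "cpl s"] by (simp add: cpl_involution)
    ultimately show False
      using \<open>\<not> s \<le> p\<close> by (blast intro: order_trans)
  qed
  moreover have "program_over {a} P" "valuation_on {a} B\<^sub>I" "valuation_on {a} B\<^sub>R"
    by (auto simp: program_over_def valuation_on_def P_def B\<^sub>I_def B\<^sub>R_def)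
  ultimately show thesis
    by (rule that)
qed

theorem theorem4p6:
  fixes cpl :: "'t::complete_lattice \<Rightarrow> 't"
  assumes sup_Inf_distrib: "\<And>(a::'t) S. sup a (Inf S) = (INF s\<in>S. sup a s)"
    and inf_Sup_distrib: "\<And>(a::'t) S. inf a (Sup S) = (SUP s\<in>S. inf a s)"
    and cpl_antimono: "\<And>a b. a \<le> b \<Longrightarrow> cpl b \<le> cpl a"
    and cpl_involution: "\<And>a. cpl (cpl a) = a"
  shows "(\<forall>(U::'u set) (P::('u, 't) annotated_program) B\<^sub>I B\<^sub>R.
            program_over U P \<longrightarrow> valuation_on U B\<^sub>I \<longrightarrow> valuation_on U B\<^sub>R \<longrightarrow>
            (F_justified_revision cpl P B\<^sub>I B\<^sub>R \<longleftrightarrow> justified_revision cpl P B\<^sub>I B\<^sub>R))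
         \<longleftrightarrow> (\<forall>\<alpha> \<beta>::'t. \<alpha> \<le> \<beta> \<or> \<beta> \<le> \<alpha>)"
proof
  assume coincide: "\<forall>(U::'u set) (P::('u, 't) annotated_program) B\<^sub>I B\<^sub>R.
    program_over U P \<longrightarrow> valuation_on U B\<^sub>I \<longrightarrow> valuation_on U B\<^sub>R \<longrightarrow>
    (F_justified_revision cpl P B\<^sub>I B\<^sub>R \<longleftrightarrow> justified_revision cpl P B\<^sub>I B\<^sub>R)"
  show "\<forall>\<alpha> \<beta>::'t. \<alpha> \<le> \<beta> \<or> \<beta> \<le> \<alpha>"
  proof (rule ccontr)
    assume "\<not> (\<forall>\<alpha> \<beta>::'t. \<alpha> \<le> \<beta> \<or> \<beta> \<le> \<alpha>)"
    then obtain \<alpha> \<beta> :: 't where "\<not> \<alpha> \<le> \<beta>" "\<not> \<beta> \<le> \<alpha>"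
      by blast
    have "antimono cpl"
      by (intro antimonoI cpl_antimono)
    \<comment> \<open>One atom suffices, and \<open>undefined\<close> names one because types are
      nonempty.\<close>
    obtain P :: "('u, 't) annotated_program" and B\<^sub>I B\<^sub>R
      where "justified_revision cpl P B\<^sub>I B\<^sub>R" "\<not> F_justified_revision cpl P B\<^sub>I B\<^sub>R"
        and "program_over {undefined} P" "valuation_on {undefined} B\<^sub>I" "valuation_on {undefined} B\<^sub>R"
      by (rule justified_but_not_F_justified[OF sup_Inf_distrib \<open>antimono cpl\<close> cpl_involution
            \<open>\<not> \<alpha> \<le> \<beta>\<close> \<open>\<not> \<beta> \<le> \<alpha>\<close>])
    with coincide show False
      by blast
  qed
next
  assume "\<forall>\<alpha> \<beta>::'t. \<alpha> \<le> \<beta> \<or> \<beta> \<le> \<alpha>"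
  then show "\<forall>(U::'u set) (P::('u, 't) annotated_program) B\<^sub>I B\<^sub>R.
    program_over U P \<longrightarrow> valuation_on U B\<^sub>I \<longrightarrow> valuation_on U B\<^sub>R \<longrightarrow>
    (F_justified_revision cpl P B\<^sub>I B\<^sub>R \<longleftrightarrow> justified_revision cpl P B\<^sub>I B\<^sub>R)"
    by (simp add: F_justified_revision_def justified_revision_def NC_reduct_eq_NC_F_reduct)
qed

end
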